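(* For every $\rho\in(0,1]$, there exists a family of SMC instances with ternary valuations (with the number $n$ of men growing to infinity along the family) for which any support of any $\rho$-efficient stable fractional matching consists of $\Omega(\rho n)$ integral matchings.
   Context: An SMC instance is a tuple $\langle M,W,U,V\rangle$ with $n$ men $M$, $n$ women $W$, and $n\times n$ matrices $U,V$ of non-negative rational numbers; $U(m,w)$ is the value of man $m$ for woman $w$ and $V(m,w)$ is the value of woman $w$ for man $m$. Ternary valuations means $U,V\in\{0,1,\alpha\}^{n\times n}$ for some $\alpha>1$ (which may depend on the instance). A fractional matching is $\mu:M\times W\to\mathbb R_{\ge0}$ with $\sum_w\mu(m,w)\le1$ for all $m$ and $\sum_m\mu(m,w)\le1$ for all $w$; it is complete if all these hold with equality, and integral if all values lie in $\{0,1\}$. Unless stated otherwise, matchings (fractional or integral) are assumed complete. Utilities: $u_m(\mu)=\sum_w U(m,w)\mu(m,w)$, $v_w(\mu)=\sum_m V(m,w)\mu(m,w)$. The matching $\mu$ is stable if for every $(m,w)\in M\times W$, $u_m(\mu)\ge U(m,w)$ or $v_w(\mu)\ge V(m,w)$. Social welfare: $\mathcal W(\mu)=\sum_m u_m(\mu)+\sum_w v_w(\mu)$. A stable fractional matching $\mu$ is $\rho$-efficient if $\mathcal W(\mu)\ge\rho\,\mathcal W(\mu^* )$, where $\mu^*$ maximizes $\mathcal W$ among all stable fractional matchings. A support of $\mu$ is a set of integral matchings $\{\mu^{(1)},\dots,\mu^{(k)}\}$ such that $\mu=\sum_{j=1}^k\lambda_j\mu^{(j)}$ for some $\lambda_j>0$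 with $\sum_j\lambda_j=1$; a matching can have several supports. *)

theory Defs
  imports Complex_Main "HOL-Library.FuncSet"
begin

record ('m, 'w) smc =
  men :: "'m set"
  women :: "'w set"
  man_val :: "'m \<Rightarrow> 'w \<Rightarrow> rat"
  woman_val :: "'m \<Rightarrow> 'w \<Rightarrow> rat"

text \<open>
  \<^term>\<open>man_val I m w\<close> is the value of man \<open>m\<close> for woman \<open>w\<close> (the matrix \<open>U\<close>), and
  \<^term>\<open>woman_val I m w\<close> is the value of woman \<open>w\<close> for man \<open>m\<close> (the matrix \<open>V\<close>); the man is
  the first index of both.
\<close>

definition smc_instance :: "('m, 'w) smc \<Rightarrow> bool" where
  "smc_instance I \<longleftrightarrow>
     finite (men I) \<and> finite (women I) \<and> card (men I) = card (women I) \<and>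
     (\<forall>m\<in>men I. \<forall>w\<in>women I. man_val I m w \<ge> 0 \<and> woman_val I m w \<ge> 0)"

definition ternary :: "('m, 'w) smc \<Rightarrow> bool" where
  "ternary I \<longleftrightarrow>
     (\<exists>\<alpha>>1. \<forall>m\<in>men I. \<forall>w\<in>women I.
        man_val I m w \<in> {0, 1, \<alpha>} \<and> woman_val I m w \<in> {0, 1, \<alpha>})"

text \<open>
  Matchings are extensional functions, so that equality of matchings (and hence the cardinality
  of a set of matchings) depends only on their values on \<^term>\<open>men I \<times> women I\<close>.
\<close>

definition fractional_matching :: "('m, 'w) smc \<Rightarrow> ('m \<times> 'w \<Rightarrow> real) \<Rightarrow> bool" where
  "fractional_matching I \<mu> \<longleftrightarrow>
     \<mu> \<in> men I \<times> women I \<rightarrow>\<^sub>E {0..} \<and>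
     (\<forall>m\<in>men I. (\<Sum>w\<in>women I. \<mu> (m, w)) \<le> 1) \<and>
     (\<forall>w\<in>women I. (\<Sum>m\<in>men I. \<mu> (m, w)) \<le> 1)"

definition complete_matching :: "('m, 'w) smc \<Rightarrow> ('m \<times> 'w \<Rightarrow> real) \<Rightarrow> bool" where
  "complete_matching I \<mu> \<longleftrightarrow>
     fractional_matching I \<mu> \<and>
     (\<forall>m\<in>men I. (\<Sum>w\<in>women I. \<mu> (m, w)) = 1) \<and>
     (\<forall>w\<in>women I. (\<Sum>m\<in>men I. \<mu> (m, w)) = 1)"

definition integral_matching :: "('m, 'w) smc \<Rightarrow> ('m \<times> 'w \<Rightarrow> real) \<Rightarrow> bool" where
  "integral_matching I \<mu> \<longleftrightarrow>
     complete_matching I \<mu> \<and> (\<forall>m\<in>men I. \<forall>w\<in>women I. \<mu> (m, w) \<in> {0, 1})"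

definition man_utility :: "('m, 'w) smc \<Rightarrow> ('m \<times> 'w \<Rightarrow> real) \<Rightarrow> 'm \<Rightarrow> real" where
  "man_utility I \<mu> m = (\<Sum>w\<in>women I. of_rat (man_val I m w) * \<mu> (m, w))"

definition woman_utility :: "('m, 'w) smc \<Rightarrow> ('m \<times> 'w \<Rightarrow> real) \<Rightarrow> 'w \<Rightarrow> real" where
  "woman_utility I \<mu> w = (\<Sum>m\<in>men I. of_rat (woman_val I m w) * \<mu> (m, w))"

definition welfare :: "('m, 'w) smc \<Rightarrow> ('m \<times> 'w \<Rightarrow> real) \<Rightarrow> real" where
  "welfare I \<mu> = (\<Sum>m\<in>men I. man_utility I \<mu> m) + (\<Sum>w\<in>women I. woman_utility I \<mu> w)"

definition stable_matching :: "('m, 'w) smc \<Rightarrow> ('m \<times> 'w \<Rightarrow> real) \<Rightarrow> bool" where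
  "stable_matching I \<mu> \<longleftrightarrow>
     complete_matching I \<mu> \<and>
     (\<forall>m\<in>men I. \<forall>w\<in>women I.
        man_utility I \<mu> m \<ge> of_rat (man_val I m w) \<or>
        woman_utility I \<mu> w \<ge> of_rat (woman_val I m w))"

definition optimal_stable_matching :: "('m, 'w) smc \<Rightarrow> ('m \<times> 'w \<Rightarrow> real) \<Rightarrow> bool" where
  "optimal_stable_matching I \<mu> \<longleftrightarrow>
     stable_matching I \<mu> \<and> (\<forall>\<nu>. stable_matching I \<nu> \<longrightarrow> welfare I \<nu> \<le> welfare I \<mu>)"

text \<open>
  An optimal stable matching always exists (the stable matchings form a nonempty compact set),
  so the existential quantifier below only names it.
\<close>

definition efficient :: "('m, 'w) smc \<Rightarrow> real \<Rightarrow> ('m \<times> 'w \<Rightarrow> real) \<Rightarrow> bool" where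
  "efficient I \<rho> \<mu> \<longleftrightarrow>
     stable_matching I \<mu> \<and>
     (\<exists>\<mu>'. optimal_stable_matching I \<mu>' \<and> welfare I \<mu> \<ge> \<rho> * welfare I \<mu>')"

definition support_of :: "('m, 'w) smc \<Rightarrow> ('m \<times> 'w \<Rightarrow> real) \<Rightarrow> ('m \<times> 'w \<Rightarrow> real) set \<Rightarrow> bool" where
  "support_of I \<mu> S \<longleftrightarrow>
     finite S \<and> (\<forall>\<nu>\<in>S. integral_matching I \<nu>) \<and>
     (\<exists>c :: ('m \<times> 'w \<Rightarrow> real) \<Rightarrow> real.
        (\<forall>\<nu>\<in>S. c \<nu> > 0) \<and> (\<Sum>\<nu>\<in>S. c \<nu>) = 1 \<and>
        (\<forall>m\<in>men I. \<forall>w\<in>women I. \<mu> (m, w) = (\<Sum>\<nu>\<in>S. c \<nu> * \<nu> (m, w))))"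

end

theory Submission
  imports Defs
begin

text \<open>
  Take \<open>k\<close> men \<open>m\<close>, each with a private woman \<open>m\<close> who values him \<open>\<alpha>\<close> (and whom he values \<open>0\<close>) and a
  private woman \<open>k + m\<close> such that the two value each other \<open>1\<close>. All \<open>k\<close> men value the common woman
  \<open>2k\<close> at \<open>\<alpha>\<close>; the other \<open>k + 1\<close> men only complete the market. Stability of the pair \<open>(m, k + m)\<close>
  forces man \<open>m\<close> to be matched entirely to woman \<open>k + m\<close>, which yields welfare \<open>2\<close> only, unless he
  gets a positive share of the common woman. Since \<open>\<alpha> \<ge> k\<close>, a share of \<open>1/k\<close> is enough to make
  him content, so the optimal welfare is at least \<open>\<alpha>k\<close>. Hence in a \<open>\<rho>\<close>-efficient stable matching
  the common woman has about \<open>\<rho>k\<close> partners at least, and every integral matching covers only one.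
\<close>

section \<open>Supports and the partners of one woman\<close>

text \<open>A nonzero share of \<open>w\<close> must come from some member of the support. Choosing
  one for each partner is injective: an integral matching that gave two men value 1 at
  \<open>w\<close> would have column sum at least 2.\<close>

lemma card_partners_le_card_support:
  assumes I: "finite (men I)" and S: "support_of I \<mu> S" and w: "w \<in> women I"
  shows "card {m \<in> men I. \<mu> (m, w) \<noteq> 0} \<le> card S"
proof -
  obtain c where fin: "finite S" and int: "\<And>\<nu>. \<nu> \<in> S \<Longrightarrow> integral_matching I \<nu>"
    and eq: "\<And>m. m \<in> men I \<Longrightarrow> \<mu> (m, w) = (\<Sum>\<nu>\<in>S. c \<nu> * \<nu> (m, w))"
    using S w unfolding support_of_def by auto
  have "\<exists>\<nu>. \<nu> \<in> S \<and> \<nu> (m, w) \<noteq> 0" if "m \<in> {m \<in> men I. \<mu> (m, w) \<noteq> 0}" for m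
    using that eq[of m] sum.neutral[of S "\<lambda>\<nu>. c \<nu> * \<nu> (m, w)"] by fastforce
  then obtain f where f: "\<And>m. m \<in> men I \<Longrightarrow> \<mu> (m, w) \<noteq> 0 \<Longrightarrow> f m \<in> S \<and> f m (m, w) \<noteq> 0"
    by (metis (mono_tags, lifting) mem_Collect_eq)
  have "inj_on f {m \<in> men I. \<mu> (m, w) \<noteq> 0}"
  proof (rule inj_onI, rule ccontr)
    fix m m' assume m: "m \<in> {m \<in> men I. \<mu> (m, w) \<noteq> 0}" and m': "m' \<in> {m \<in> men I. \<mu> (m, w) \<noteq> 0}"
      and ff: "f m = f m'" and ne: "m \<noteq> m'"
    have M: "integral_matching I (f m)" using f m int by auto
    then have one: "f m (m, w) = 1" "f m (m', w) = 1"
      using f m m' w ff by (fastforce simp: integral_matching_def)+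
    have "(\<Sum>i\<in>{m, m'}. f m (i, w)) \<le> (\<Sum>i\<in>men I. f m (i, w))"
      using M I m m' w
      by (intro sum_mono2)
         (auto simp: integral_matching_def complete_matching_def fractional_matching_def PiE_iff)
    also have "\<dots> = 1"
      using M w by (auto simp: integral_matching_def complete_matching_def)
    finally show False using one ne by simp
  qed
  then show ?thesis
    using f fin by (intro card_inj_on_le[of f]) auto
qed

lemma welfare_alt:
  "welfare I \<mu> = (\<Sum>m\<in>men I. \<Sum>w\<in>women I.
     (of_rat (man_val I m w) + of_rat (woman_val I m w)) * \<mu> (m, w))"
proof -
  have "(\<Sum>w\<in>women I. woman_utility I \<mu> w) =
      (\<Sum>m\<in>men I. \<Sum>w\<in>women I. of_rat (woman_val I m w) * \<mu> (m, w))"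
    unfolding woman_utility_def by (rule sum.swap)
  then show ?thesis
    by (simp add: welfare_def man_utility_def sum.distrib distrib_right)
qed

section \<open>The family of markets\<close>

text \<open>Taking \<open>k + 2\<close> for \<alpha> keeps it above 1 for every \<open>k\<close>,
  including 0, so the whole family is ternary.\<close>

definition shared_woman_market :: "nat \<Rightarrow> (nat, nat) smc" where
  "shared_woman_market k =
     \<lparr>men = {..2 * k}, women = {..2 * k},
      man_val = (\<lambda>m w. if m < k \<and> w = 2 * k then of_nat (k + 2)
                       else if m < k \<and> w = k + m then 1 else 0),
      woman_val = (\<lambda>m w. if m < k \<and> w = m then of_nat (k + 2)
                         else if m < k \<and> w = k + m then 1 else 0)\<rparr>"

lemma men_market [simp]: "men (shared_woman_market k) = {..2 * k}"
  and women_market [simp]: "women (shared_woman_market k) = {..2 * k}"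
  by (simp_all add: shared_woman_market_def)

text \<open>The two conditions exclude each other, since \<open>m < k\<close> gives
  \<open>k + m < 2 * k\<close>. Written as a sum of indicators, the values let sums over women split
  and collapse to single terms.\<close>

lemma man_val_market:
  "(of_rat (man_val (shared_woman_market k) m w) :: real) =
     (if m < k \<and> w = 2 * k then real (k + 2) else 0) + (if m < k \<and> w = k + m then 1 else 0)"
  by (auto simp: shared_woman_market_def of_rat_add)

lemma woman_val_market:
  "(of_rat (woman_val (shared_woman_market k) m w) :: real) =
     (if m < k \<and> w = m then real (k + 2) else 0) + (if m < k \<and> w = k + m then 1 else 0)"
  by (auto simp: shared_woman_market_def of_rat_add)

lemma smc_instance_market: "smc_instance (shared_woman_market k)"
  by (auto simp: smc_instance_def shared_woman_market_def)

lemma ternary_market: "ternary (shared_woman_market k)"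
  unfolding ternary_def
  by (rule exI[of _ "of_nat (k + 2)"]) (auto simp: shared_woman_market_def)

lemma man_utility_market:
  "man_utility (shared_woman_market k) \<mu> m =
     (if m < k then real (k + 2) * \<mu> (m, 2 * k) + \<mu> (m, k + m) else 0)"
  by (simp add: man_utility_def man_val_market distrib_right sum.distrib if_distrib[of "\<lambda>a. a * _"]
      cong: if_cong)

lemma woman_utility_market:
  assumes "m < k"
  shows "woman_utility (shared_woman_market k) \<mu> (k + m) = \<mu> (m, k + m)"
proof -
  have "woman_utility (shared_woman_market k) \<mu> (k + m) =
      (\<Sum>i\<le>2 * k. if i = m then \<mu> (m, k + m) else 0)"
    unfolding woman_utility_def using assms by (intro sum.cong) (auto simp: woman_val_market)
  then show ?thesis using assms by simp
qed

lemma welfare_market: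
  "welfare (shared_woman_market k) \<mu> =
     (\<Sum>m<k. real (k + 2) * \<mu> (m, m) + 2 * \<mu> (m, k + m) + real (k + 2) * \<mu> (m, 2 * k))"
proof -
  have "(\<Sum>w\<le>2 * k. (of_rat (man_val (shared_woman_market k) m w)
          + of_rat (woman_val (shared_woman_market k) m w)) * \<mu> (m, w)) =
      (if m < k then real (k + 2) * \<mu> (m, m) + 2 * \<mu> (m, k + m) + real (k + 2) * \<mu> (m, 2 * k) else 0)"
    for m
    by (simp add: man_val_market woman_val_market distrib_right sum.distrib
        if_distrib[of "\<lambda>a. a * _"] if_distrib[of "\<lambda>a. 2 * a"] cong: if_cong)
  then have "welfare (shared_woman_market k) \<mu> = (\<Sum>m\<le>2 * k. if m < k then
      real (k + 2) * \<mu> (m, m) + 2 * \<mu> (m, k + m) + real (k + 2) * \<mu> (m, 2 * k) else 0)"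
    by (simp add: welfare_alt)
  also have "\<dots> = (\<Sum>m<k. real (k + 2) * \<mu> (m, m) + 2 * \<mu> (m, k + m) + real (k + 2) * \<mu> (m, 2 * k))"
    by (intro sum.mono_neutral_cong_right) auto
  finally show ?thesis .
qed

section \<open>A stable matching of high welfare\<close>

text \<open>The common woman is shared equally by the men below \<open>k\<close>. Man
  \<open>2 * k\<close> supplies the \<open>1 / k\<close> that each woman below \<open>k\<close> then
  lacks, and the remaining men take the women from \<open>k\<close> to
  \<open>2 * k - 1\<close>.\<close>

definition spread_matching :: "nat \<Rightarrow> nat \<times> nat \<Rightarrow> real" where
  "spread_matching k = restrict (\<lambda>(m, w).
     if m < k then (if w = m then 1 - 1 / real k else 0) + (if w = 2 * k then 1 / real k else 0)
     else if m < 2 * k then (if w = m then 1 else 0)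
     else (if w < k then 1 / real k else 0)) ({..2 * k} \<times> {..2 * k})"

lemma complete_spread_matching:
  assumes k: "k > 0"
  shows "complete_matching (shared_woman_market k) (spread_matching k)"
proof -
  have low: "(\<Sum>i\<le>2 * k. if i < k then a else (0::real)) = real k * a" for a
  proof -
    have "(\<Sum>i\<le>2 * k. if i < k then a else 0) = (\<Sum>i<k. a)"
      by (intro sum.mono_neutral_cong_right) auto
    then show ?thesis by simp
  qed
  have row: "(\<Sum>w\<le>2 * k. spread_matching k (m, w)) = 1" if "m \<le> 2 * k" for m
    using that k low[of "1 / real k"]
    by (cases "m < k"; cases "m < 2 * k") (auto simp: spread_matching_def sum.distrib)
  have col: "(\<Sum>m\<le>2 * k. spread_matching k (m, w)) = 1" if w: "w \<le> 2 * k" for w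
  proof -
    consider "w < k" | "k \<le> w" "w < 2 * k" | "w = 2 * k" using w by linarith
    then show ?thesis
    proof cases
      case 1
      then have "(\<Sum>m\<le>2 * k. spread_matching k (m, w)) =
          (\<Sum>m\<le>2 * k. (if m = w then 1 - 1 / real k else 0) + (if m = 2 * k then 1 / real k else 0))"
        by (intro sum.cong) (auto simp: spread_matching_def)
      then show ?thesis using 1 by (simp add: sum.distrib)
    next
      case 2
      then have "(\<Sum>m\<le>2 * k. spread_matching k (m, w)) = (\<Sum>m\<le>2 * k. if m = w then 1 else 0)"
        by (intro sum.cong) (auto simp: spread_matching_def)
      then show ?thesis using 2 by simp
    next
      case 3
      then have "(\<Sum>m\<le>2 * k. spread_matching k (m, w)) =
          (\<Sum>m\<le>2 * k. if m < k then 1 / real k else 0)"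
        by (intro sum.cong) (auto simp: spread_matching_def)
      then show ?thesis using k low by simp
    qed
  qed
  have "spread_matching k \<in> {..2 * k} \<times> {..2 * k} \<rightarrow>\<^sub>E {0..}"
    using k by (auto simp: spread_matching_def)
  then show ?thesis
    using row col by (auto simp: complete_matching_def fractional_matching_def)
qed

text \<open>A man below \<open>k\<close> has utility \<open>(k + 2) / k\<close>, at least 1, so only
  the common woman could tempt him, and she values everybody 0. The other men value every woman
  0.\<close>

lemma stable_spread_matching:
  assumes k: "k > 0"
  shows "stable_matching (shared_woman_market k) (spread_matching k)"
proof -
  have content: "man_utility (shared_woman_market k) (spread_matching k) m \<ge> 1" if "m < k" for m
    using that by (simp add: man_utility_market spread_matching_def field_simps)
  have nonneg: "spread_matching k (i, w) \<ge> 0" if "i \<le> 2 * k" "w \<le> 2 * k" for i w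
    using complete_spread_matching[OF k] that
    by (auto simp: complete_matching_def fractional_matching_def PiE_iff)
  have "man_utility (shared_woman_market k) (spread_matching k) m \<ge>
          of_rat (man_val (shared_woman_market k) m w) \<or>
        woman_utility (shared_woman_market k) (spread_matching k) w \<ge>
          of_rat (woman_val (shared_woman_market k) m w)"
    if m: "m \<le> 2 * k" and w: "w \<le> 2 * k" for m w
  proof (cases "m < k \<and> w = 2 * k")
    case True
    have "woman_utility (shared_woman_market k) (spread_matching k) w \<ge> 0"
      unfolding woman_utility_def using w nonneg
      by (auto intro!: sum_nonneg simp: woman_val_market)
    moreover have "of_rat (woman_val (shared_woman_market k) m w) = (0::real)"
      using True by (simp add: woman_val_market)
    ultimately show ?thesis by simp
  next
    case False
    then have "of_rat (man_val (shared_woman_market k) m w) \<le> (if m < k then 1 else 0 :: real)"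
      by (simp add: man_val_market)
    also have "\<dots> \<le> man_utility (shared_woman_market k) (spread_matching k) m"
      using content by (simp add: man_utility_market)
    finally show ?thesis by simp
  qed
  then show ?thesis
    using complete_spread_matching[OF k] by (auto simp: stable_matching_def)
qed

text \<open>Each man below \<open>k\<close> puts all his mass on pairs of joint value
  \<open>k + 2\<close>.\<close>

lemma welfare_spread_matching:
  assumes "k > 0"
  shows "welfare (shared_woman_market k) (spread_matching k) = real (k + 2) * real k"
proof -
  have "welfare (shared_woman_market k) (spread_matching k) = (\<Sum>m<k. real (k + 2))"
    unfolding welfare_market by (intro sum.cong) (auto simp: spread_matching_def field_simps)
  then show ?thesis by simp
qed

section \<open>Welfare against the number of partners of the common woman\<close>

text \<open>A pair \<open>(m, m)\<close> has positive mass only if \<open>m\<close> is a partner of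
  the common woman. Her own column adds at most \<open>k + 2\<close>, and the pairs
  \<open>(m, k + m)\<close> add at most 2 each.\<close>

lemma welfare_stable_le:
  assumes stable: "stable_matching (shared_woman_market k) \<mu>"
  shows "welfare (shared_woman_market k) \<mu>
    \<le> real (k + 2) * (real (card {m \<in> {..2 * k}. \<mu> (m, 2 * k) \<noteq> 0}) + 1) + 2 * real k"
proof -
  let ?P = "{m \<in> {..2 * k}. \<mu> (m, 2 * k) \<noteq> 0}"
  have nonneg: "\<mu> (m, w) \<ge> 0" if "m \<le> 2 * k" "w \<le> 2 * k" for m w
    using stable that
    by (auto simp: stable_matching_def complete_matching_def fractional_matching_def PiE_iff)
  have row: "(\<Sum>w\<le>2 * k. \<mu> (m, w)) = 1" if "m \<le> 2 * k" for m
    using stable that by (auto simp: stable_matching_def complete_matching_def)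
  have col: "(\<Sum>m\<le>2 * k. \<mu> (m, 2 * k)) = 1"
    using stable by (auto simp: stable_matching_def complete_matching_def)
  have bound: "real (k + 2) * \<mu> (m, m) + 2 * \<mu> (m, k + m) + real (k + 2) * \<mu> (m, 2 * k)
      \<le> real (k + 2) * of_bool (m \<in> ?P) + 2 + real (k + 2) * \<mu> (m, 2 * k)" if m: "m < k" for m
  proof -
    have "(\<Sum>w\<in>{m, k + m}. \<mu> (m, w)) \<le> (\<Sum>w\<le>2 * k. \<mu> (m, w))"
      using m nonneg by (intro sum_mono2) auto
    then have share: "\<mu> (m, m) + \<mu> (m, k + m) \<le> 1"
      using m row[of m] by simp
    have "m \<in> {..2 * k}" "k + m \<in> {..2 * k}" using m by auto
    then have "of_rat (man_val (shared_woman_market k) m (k + m))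
            \<le> man_utility (shared_woman_market k) \<mu> m \<or>
          of_rat (woman_val (shared_woman_market k) m (k + m))
            \<le> woman_utility (shared_woman_market k) \<mu> (k + m)"
      using stable unfolding stable_matching_def men_market women_market by blast
    then have "1 \<le> man_utility (shared_woman_market k) \<mu> m \<or>
          1 \<le> woman_utility (shared_woman_market k) \<mu> (k + m)"
      using m by (simp add: man_val_market woman_val_market)
    \<comment> \<open>Both alternatives give this: the utility of woman \<open>k + m\<close> is just
      \<open>\<mu> (m, k + m)\<close>, and the other term is nonnegative.\<close>
    then have "1 \<le> real (k + 2) * \<mu> (m, 2 * k) + \<mu> (m, k + m)"
      using m nonneg[of m "2 * k"]
      by (auto simp: man_utility_market woman_utility_market intro: add_increasing)
    \<comment> \<open>Outside \<open>?P\<close> the previous bound forces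
      \<open>\<mu> (m, k + m)\<close> to be at least 1, so \<open>share\<close> leaves nothing for
      \<open>(m, m)\<close>.\<close>
    then have "\<mu> (m, m) \<le> of_bool (m \<in> ?P)"
      using share m nonneg[of m "k + m"] by (cases "m \<in> ?P") auto
    moreover have "\<mu> (m, k + m) \<le> 1"
      using share m nonneg[of m m] by simp
    ultimately show ?thesis
      by (intro add_mono mult_left_mono) auto
  qed
  have "(\<Sum>m<k. of_bool (m \<in> ?P)) = real (card {m \<in> {..<k}. m \<in> ?P})"
    by (auto simp: Int_def intro!: arg_cong[of _ _ card])
  also have "\<dots> \<le> real (card ?P)"
    by (intro of_nat_mono card_mono) auto
  finally have cnt: "(\<Sum>m<k. of_bool (m \<in> ?P)) \<le> real (card ?P)" .
  have mass: "(\<Sum>m<k. \<mu> (m, 2 * k)) \<le> 1"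
    unfolding col[symmetric] using nonneg by (intro sum_mono2) auto
  have "welfare (shared_woman_market k) \<mu>
      \<le> (\<Sum>m<k. real (k + 2) * of_bool (m \<in> ?P) + 2 + real (k + 2) * \<mu> (m, 2 * k))"
    unfolding welfare_market using bound by (intro sum_mono) auto
  also have "\<dots> = real (k + 2) * ((\<Sum>m<k. of_bool (m \<in> ?P)) + (\<Sum>m<k. \<mu> (m, 2 * k))) + 2 * real k"
    by (simp only: sum.distrib sum_distrib_left distrib_left) simp
  also have "\<dots> \<le> real (k + 2) * (real (card ?P) + 1) + 2 * real k"
    using cnt mass by (intro add_mono mult_left_mono) auto
  finally show ?thesis .
qed

lemma card_support_efficient_ge:
  assumes k: "k > 0" and \<rho>: "\<rho> \<ge> 0" and eff: "efficient (shared_woman_market k) \<rho> \<mu>"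
    and S: "support_of (shared_woman_market k) \<mu> S"
  shows "real (card S) \<ge> \<rho> * real k - 3"
proof -
  let ?P = "{m \<in> {..2 * k}. \<mu> (m, 2 * k) \<noteq> 0}"
  obtain \<mu>' where "optimal_stable_matching (shared_woman_market k) \<mu>'"
    and stable: "stable_matching (shared_woman_market k) \<mu>"
    and \<mu>': "welfare (shared_woman_market k) \<mu> \<ge> \<rho> * welfare (shared_woman_market k) \<mu>'"
    using eff by (auto simp: efficient_def)
  then have "real (k + 2) * real k \<le> welfare (shared_woman_market k) \<mu>'"
    using stable_spread_matching[OF k] welfare_spread_matching[OF k]
    by (metis optimal_stable_matching_def)
  then have "\<rho> * (real (k + 2) * real k) \<le> welfare (shared_woman_market k) \<mu>"
    using \<mu>' \<rho> by (meson mult_left_mono order_trans)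
  also have "\<dots> \<le> real (k + 2) * (real (card ?P) + 1) + 2 * real k"
    by (rule welfare_stable_le[OF stable])
  \<comment> \<open>Bounding \<open>2 * k\<close> by \<open>2 * (k + 2)\<close> turns the 1 into 3
    and lets the factor \<open>k + 2\<close> cancel.\<close>
  also have "\<dots> \<le> real (k + 2) * (real (card ?P) + 3)"
    by (simp add: algebra_simps)
  finally have "real (k + 2) * (\<rho> * real k) \<le> real (k + 2) * (real (card ?P) + 3)"
    by (simp add: mult_ac)
  then have "\<rho> * real k \<le> real (card ?P) + 3"
    by (rule mult_left_le_imp_le) simp
  moreover have "card ?P \<le> card S"
    using card_partners_le_card_support[OF _ S, of "2 * k"] by simp
  ultimately show ?thesis by linarith
qed

theorem theorem3:
  "\<exists>C::real. C > 0 \<and>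
     (\<forall>\<rho>::real. 0 < \<rho> \<and> \<rho> \<le> 1 \<longrightarrow>
       (\<exists>I :: nat \<Rightarrow> (nat, nat) smc.
          (\<forall>k. smc_instance (I k) \<and> ternary (I k)) \<and>
          filterlim (\<lambda>k. card (men (I k))) at_top sequentially \<and>
          (\<forall>\<^sub>F k in sequentially. \<forall>\<mu> S.
             efficient (I k) \<rho> \<mu> \<and> support_of (I k) \<mu> S \<longrightarrow>
             real (card S) \<ge> C * \<rho> * real (card (men (I k))))))"
proof (intro exI[of _ "1 / 4"] conjI allI impI)
  fix \<rho> :: real assume \<rho>: "0 < \<rho> \<and> \<rho> \<le> 1"
  show "\<exists>I :: nat \<Rightarrow> (nat, nat) smc.
          (\<forall>k. smc_instance (I k) \<and> ternary (I k)) \<and>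
          filterlim (\<lambda>k. card (men (I k))) at_top sequentially \<and>
          (\<forall>\<^sub>F k in sequentially. \<forall>\<mu> S.
             efficient (I k) \<rho> \<mu> \<and> support_of (I k) \<mu> S \<longrightarrow>
             real (card S) \<ge> 1 / 4 * \<rho> * real (card (men (I k))))"
  proof (intro exI[of _ shared_woman_market] conjI)
    show "\<forall>k. smc_instance (shared_woman_market k) \<and> ternary (shared_woman_market k)"
      using smc_instance_market ternary_market by blast
    show "filterlim (\<lambda>k. card (men (shared_woman_market k))) at_top sequentially"
      by (rule filterlim_at_top_mono[OF filterlim_ident]) auto
    \<comment> \<open>There are \<open>2 * k + 1\<close> men, so the lower bound
      \<open>\<rho> * k - 3\<close> suffices for the constant 1/4 once \<open>\<rho> * k\<close> is
      at least \<open>6 + \<rho> / 2\<close>; as \<rho> is at most 1, 7 is enough.\<close>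
    have "\<forall>\<^sub>F k in sequentially. real k \<ge> 7 / \<rho>"
      using filterlim_real_sequentially by (auto simp: filterlim_at_top)
    then show "\<forall>\<^sub>F k in sequentially. \<forall>\<mu> S.
        efficient (shared_woman_market k) \<rho> \<mu> \<and> support_of (shared_woman_market k) \<mu> S \<longrightarrow>
        real (card S) \<ge> 1 / 4 * \<rho> * real (card (men (shared_woman_market k)))"
    proof eventually_elim
      case (elim k)
      then have large: "\<rho> * real k \<ge> 7" using \<rho> by (simp add: field_simps)
      then have "k > 0" by (cases k) auto
      moreover have "1 / 4 * \<rho> * real (card (men (shared_woman_market k))) \<le> \<rho> * real k - 3"
        using large \<rho> by (simp add: algebra_simps)
      ultimately show ?case
        using card_support_efficient_ge[of k \<rho>] \<rho> by fastforce
    qed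
  qed
qed simp

end
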